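(* Let $(\mathfrak{g}_-,h_-,E_-)$ be a flat bi-Lagrangian Lie algebra of dimension $2n$ with Levi-Civita connection $\nabla^-$. Let $\mathfrak{g}_+=\mathbb{R}^{2n}$ (abelian), let $Q\colon\mathfrak{g}_+\to\mathfrak{g}_-$ be an isomorphism of vector spaces, set $h_+=Q^*h_-$ and $E_+=-Q^{-1}E_-Q$, and define the representation $\varphi\colon\mathfrak{g}_-\to\mathrm{Der}(\mathfrak{g}_+)$ by $\varphi(X_-)=Q^{-1}\nabla^-_{X_-}Q$. Set $$h=\begin{pmatrix}h_+&0\\0&h_-\end{pmatrix},\quad J=\begin{pmatrix}0&-Q^{-1}\\Q&0\end{pmatrix},\quad E=\begin{pmatrix}E_+&0\\0&E_-\end{pmatrix}$$ with respect to the splitting $\mathfrak{g}_+\oplus\mathfrak{g}_-$. Then $(h,J,E)$ is a hypersymplectic structure on $\mathfrak{g}_+\rtimes_\varphi\mathfrak{g}_-$.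
   Context: All Lie algebras are real and finite-dimensional. A pseudo-Riemannian metric on a Lie algebra is a non-degenerate symmetric bilinear form of arbitrary signature; it is flat if the curvature of its Levi-Civita connection (given by the Koszul formula on the Lie algebra) vanishes. A pseudo-Kähler structure on a Lie algebra is a pair $(h,J)$ of a pseudo-Riemannian metric and an endomorphism $J$ with $J^2=-\mathrm{Id}$, $h(J\cdot,J\cdot)=h(\cdot,\cdot)$ and $\nabla^hJ=0$. A bi-Lagrangian (equivalently, para-Kähler) structure on a Lie algebra, written as a pair $(h,E)$, consists of a neutral-signature metric $h$ and an endomorphism $E$ with $E^2=\mathrm{Id}$, $h(E\cdot,E\cdot)=-h(\cdot,\cdot)$ and $\nabla^hE=0$; here $\nabla^h$ is the Levi-Civita connection of $h$. It is flat if $h$ is flat. A hypersymplectic structure on a Lie algebra is a triple $(h,J,E)$ such that $(h,J)$ is pseudo-Kähler, $(h,E)$ is bi-Lagrangian, and $J$ and $E$ anti-commute. For a representation $\varphi\colon\mathfrak{g}_-\to\mathrm{Der}(\mathfrak{g}_+)$, $\mathfrak{g}_+\rtimes_\varphi\mathfrak{g}_-$ is the Lie algebra on $\mathfrak{g}_+\oplus\mathfrak{g}_-$ with bracket $[X_++X_-,Y_++Y_-]=[X_+,Y_+]_++\varphi(X_-)Y_+-\varphi(Y_-)X_++[X_-,Y_-]_-$. *)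

theory Defs
  imports "HOL-Analysis.Analysis"
begin

text \<open>
  A real Lie algebra is given by a bracket on a whole type of class \<open>real_vector\<close>.
  \<open>dim\<close> is \<open>0\<close> on infinite-dimensional spaces, so finite-dimensionality is required separately.
\<close>

definition finite_dim_space :: "'a::real_vector itself \<Rightarrow> bool" where
  "finite_dim_space _ \<longleftrightarrow> (\<exists>B::'a set. finite B \<and> span B = UNIV)"

definition lie_algebra :: "('a::real_vector \<Rightarrow> 'a \<Rightarrow> 'a) \<Rightarrow> bool" where
  "lie_algebra br \<longleftrightarrow>
     finite_dim_space TYPE('a) \<and> bilinear br \<and> (\<forall>X. br X X = 0) \<and>
     (\<forall>X Y Z. br X (br Y Z) + br Y (br Z X) + br Z (br X Y) = 0)"

definition lie_derivation :: "('a::real_vector \<Rightarrow> 'a \<Rightarrow> 'a) \<Rightarrow> ('a \<Rightarrow> 'a) \<Rightarrow> bool" where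
  "lie_derivation br D \<longleftrightarrow> linear D \<and> (\<forall>X Y. D (br X Y) = br (D X) Y + br X (D Y))"

definition derivation_representation ::
  "('m::real_vector \<Rightarrow> 'm \<Rightarrow> 'm) \<Rightarrow> ('p::real_vector \<Rightarrow> 'p \<Rightarrow> 'p) \<Rightarrow> ('m \<Rightarrow> 'p \<Rightarrow> 'p) \<Rightarrow> bool" where
  "derivation_representation brm brp \<phi> \<longleftrightarrow>
     bilinear \<phi> \<and> (\<forall>X. lie_derivation brp (\<phi> X)) \<and>
     (\<forall>X Y. \<phi> (brm X Y) = (\<lambda>Z. \<phi> X (\<phi> Y Z) - \<phi> Y (\<phi> X Z)))"

definition semidirect_bracket ::
  "('p::real_vector \<Rightarrow> 'p \<Rightarrow> 'p) \<Rightarrow> ('m::real_vector \<Rightarrow> 'm \<Rightarrow> 'm) \<Rightarrow> ('m \<Rightarrow> 'p \<Rightarrow> 'p)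
     \<Rightarrow> 'p \<times> 'm \<Rightarrow> 'p \<times> 'm \<Rightarrow> 'p \<times> 'm" where
  "semidirect_bracket brp brm \<phi> X Y =
     (brp (fst X) (fst Y) + \<phi> (snd X) (fst Y) - \<phi> (snd Y) (fst X), brm (snd X) (snd Y))"

definition pseudo_riemannian_metric :: "('a::real_vector \<Rightarrow> 'a \<Rightarrow> real) \<Rightarrow> bool" where
  "pseudo_riemannian_metric h \<longleftrightarrow>
     bilinear h \<and> (\<forall>X Y. h X Y = h Y X) \<and> (\<forall>X. (\<forall>Y. h X Y = 0) \<longrightarrow> X = 0)"

text \<open>Signature \<open>(p, q)\<close>, witnessed by a pseudo-orthonormal basis.\<close>

definition has_signature :: "('a::real_vector \<Rightarrow> 'a \<Rightarrow> real) \<Rightarrow> nat \<Rightarrow> nat \<Rightarrow> bool" where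
  "has_signature h p q \<longleftrightarrow>
     (\<exists>P N. finite P \<and> finite N \<and> card P = p \<and> card N = q \<and> P \<inter> N = {} \<and>
        independent (P \<union> N) \<and> span (P \<union> N) = UNIV \<and>
        (\<forall>v\<in>P. h v v = 1) \<and> (\<forall>v\<in>N. h v v = -1) \<and>
        (\<forall>v\<in>P \<union> N. \<forall>w\<in>P \<union> N. v \<noteq> w \<longrightarrow> h v w = 0))"

definition neutral_signature :: "('a::real_vector \<Rightarrow> 'a \<Rightarrow> real) \<Rightarrow> bool" where
  "neutral_signature h \<longleftrightarrow> (\<exists>p. has_signature h p p)"

text \<open>
  The Koszul formula for left-invariant fields, where the derivative terms vanish.
  The description is well defined when \<open>h\<close> is a metric on a finite-dimensional Lie algebra.
\<close>

definition levi_civita ::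
  "('a::real_vector \<Rightarrow> 'a \<Rightarrow> 'a) \<Rightarrow> ('a \<Rightarrow> 'a \<Rightarrow> real) \<Rightarrow> 'a \<Rightarrow> 'a \<Rightarrow> 'a" where
  "levi_civita br h X Y =
     (THE W. \<forall>Z. 2 * h W Z = h (br X Y) Z - h (br Y Z) X + h (br Z X) Y)"

definition curvature ::
  "('a::real_vector \<Rightarrow> 'a \<Rightarrow> 'a) \<Rightarrow> ('a \<Rightarrow> 'a \<Rightarrow> real) \<Rightarrow> 'a \<Rightarrow> 'a \<Rightarrow> 'a \<Rightarrow> 'a" where
  "curvature br h X Y Z =
     levi_civita br h X (levi_civita br h Y Z) - levi_civita br h Y (levi_civita br h X Z)
     - levi_civita br h (br X Y) Z"

definition flat_metric :: "('a::real_vector \<Rightarrow> 'a \<Rightarrow> 'a) \<Rightarrow> ('a \<Rightarrow> 'a \<Rightarrow> real) \<Rightarrow> bool" where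
  "flat_metric br h \<longleftrightarrow> (\<forall>X Y Z. curvature br h X Y Z = 0)"

text \<open>\<open>\<nabla>A = 0\<close>, using \<open>(\<nabla>\<^sub>X A) Y = \<nabla>\<^sub>X (A Y) - A (\<nabla>\<^sub>X Y)\<close>.\<close>

definition parallel_endo ::
  "('a::real_vector \<Rightarrow> 'a \<Rightarrow> 'a) \<Rightarrow> ('a \<Rightarrow> 'a \<Rightarrow> real) \<Rightarrow> ('a \<Rightarrow> 'a) \<Rightarrow> bool" where
  "parallel_endo br h A \<longleftrightarrow>
     (\<forall>X Y. levi_civita br h X (A Y) - A (levi_civita br h X Y) = 0)"

definition pseudo_kaehler ::
  "('a::real_vector \<Rightarrow> 'a \<Rightarrow> 'a) \<Rightarrow> ('a \<Rightarrow> 'a \<Rightarrow> real) \<Rightarrow> ('a \<Rightarrow> 'a) \<Rightarrow> bool" where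
  "pseudo_kaehler br h J \<longleftrightarrow>
     lie_algebra br \<and> pseudo_riemannian_metric h \<and> linear J \<and>
     (\<forall>X. J (J X) = - X) \<and> (\<forall>X Y. h (J X) (J Y) = h X Y) \<and> parallel_endo br h J"

definition bi_lagrangian ::
  "('a::real_vector \<Rightarrow> 'a \<Rightarrow> 'a) \<Rightarrow> ('a \<Rightarrow> 'a \<Rightarrow> real) \<Rightarrow> ('a \<Rightarrow> 'a) \<Rightarrow> bool" where
  "bi_lagrangian br h E \<longleftrightarrow>
     lie_algebra br \<and> pseudo_riemannian_metric h \<and> neutral_signature h \<and> linear E \<and>
     (\<forall>X. E (E X) = X) \<and> (\<forall>X Y. h (E X) (E Y) = - h X Y) \<and> parallel_endo br h E"

definition flat_bi_lagrangian ::
  "('a::real_vector \<Rightarrow> 'a \<Rightarrow> 'a) \<Rightarrow> ('a \<Rightarrow> 'a \<Rightarrow> real) \<Rightarrow> ('a \<Rightarrow> 'a) \<Rightarrow> bool" where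
  "flat_bi_lagrangian br h E \<longleftrightarrow> bi_lagrangian br h E \<and> flat_metric br h"

definition hypersymplectic ::
  "('a::real_vector \<Rightarrow> 'a \<Rightarrow> 'a) \<Rightarrow> ('a \<Rightarrow> 'a \<Rightarrow> real) \<Rightarrow> ('a \<Rightarrow> 'a) \<Rightarrow> ('a \<Rightarrow> 'a) \<Rightarrow> bool" where
  "hypersymplectic br h J E \<longleftrightarrow>
     pseudo_kaehler br h J \<and> bi_lagrangian br h E \<and> (\<forall>X. J (E X) = - E (J X))"

end

theory Submission
  imports Defs
begin

text \<open>
  Everything follows from one formula: on the semidirect product of \<open>\<gg>\<^sub>+ = \<real>\<^sup>2\<^sup>n\<close> with
  \<open>\<gg>\<^sub>-\<close>, the Levi-Civita connection of \<open>h\<close> is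
  \<open>\<nabla>\<^sub>X Y = (\<phi>(X\<^sub>-) Y\<^sub>+, \<nabla>\<^sup>-\<^bsub>X\<^sub>-\<^esub> Y\<^sub>-)\<close> (\<open>levi_civita_semidirect\<close>).
  Its two summands are therefore the representations \<open>\<phi>\<close> and \<open>\<nabla>\<^sup>-\<close> of \<open>\<gg>\<^sub>-\<close>, and \<open>\<phi>\<close> is
  \<open>\<nabla>\<^sup>-\<close> conjugated by \<open>Q\<close>. Flatness of \<open>h\<^sub>-\<close> is what makes \<open>\<nabla>\<^sup>-\<close>, and hence \<open>\<phi>\<close>, a
  representation (\<open>derivation_representation_flat\<close>). Since \<open>J\<close> is built from \<open>Q\<close>, which intertwines
  the two representations, it is parallel; since \<open>E\<^sub>-\<close> commutes with \<open>\<nabla>\<^sup>-\<close>, so does its conjugate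
  with \<open>\<phi>\<close>, and \<open>E\<close> is parallel. The sign in \<open>E\<^sub>+ = -Q\<^sup>-\<^sup>1 E\<^sub>- Q\<close> makes \<open>E\<close> anti-commute
  with \<open>J\<close>.

  The formula holds because the right-hand side is torsion-free and metric: \<open>\<phi>\<close> acts by skew
  endomorphisms of \<open>h\<^sub>+ = Q\<^sup>*h\<^sub>-\<close>, as \<open>\<nabla>\<^sup>-\<close> does for \<open>h\<^sub>-\<close>, and a torsion-free metric connection
  satisfies the Koszul formula, whose solution is unique by non-degeneracy
  (\<open>levi_civita_unique\<close>). To know that \<open>\<nabla>\<^sup>-\<close> itself is torsion-free and metric one also needs
  the Koszul formula to be solvable on \<open>\<gg>\<^sub>-\<close>; this is the representation of linear functionals
  by a metric (\<open>riesz_representation\<close>), for which a pseudo-orthonormal basis provides explicit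
  coordinates.
\<close>

section \<open>Pseudo-orthonormal bases\<close>

lemma orthogonal_nonnull_independent:
  fixes h :: "'a::real_vector \<Rightarrow> 'a \<Rightarrow> real"
  assumes "bilinear h" "finite B"
    and nonnull: "\<And>v. v \<in> B \<Longrightarrow> h v v \<noteq> 0"
    and orth: "\<And>v w. v \<in> B \<Longrightarrow> w \<in> B \<Longrightarrow> v \<noteq> w \<Longrightarrow> h v w = 0"
  shows "independent B"
proof (rule independent_if_scalars_zero[OF \<open>finite B\<close>])
  fix c w assume zero: "(\<Sum>x\<in>B. c x *\<^sub>R x) = 0" and w: "w \<in> B"
  have lin: "linear (\<lambda>x. h x w)"
    using \<open>bilinear h\<close> by (simp add: bilinear_def)
  have "0 = h (\<Sum>x\<in>B. c x *\<^sub>R x) w"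
    using linear_0[OF lin] zero by simp
  also have "\<dots> = (\<Sum>x\<in>B. c x * h x w)"
    using linear_sum[OF lin, of "\<lambda>x. c x *\<^sub>R x" B] by (simp add: linear_cmul[OF lin])
  also have "\<dots> = (\<Sum>x\<in>B. if x = w then c w * h w w else 0)"
    by (rule sum.cong) (auto simp: orth w)
  also have "\<dots> = c w * h w w"
    using w \<open>finite B\<close> by simp
  finally show "c w = 0"
    using nonnull[OF w] by simp
qed

text \<open>
  Disjointness and independence come for free: a common vector would have norm both \<open>1\<close> and \<open>-1\<close>,
  and orthogonal vectors of non-zero norm are independent. Only orthogonality and spanning remain to be
  checked for a proposed basis.
\<close>

lemma has_signatureI:
  fixes h :: "'a::real_vector \<Rightarrow> 'a \<Rightarrow> real"
  assumes "bilinear h" "finite P" "finite N" "card P = p" "card N = q"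
    and P: "\<And>v. v \<in> P \<Longrightarrow> h v v = 1" and N: "\<And>v. v \<in> N \<Longrightarrow> h v v = -1"
    and orth: "\<And>v w. v \<in> P \<union> N \<Longrightarrow> w \<in> P \<union> N \<Longrightarrow> v \<noteq> w \<Longrightarrow> h v w = 0"
    and "span (P \<union> N) = UNIV"
  shows "has_signature h p q"
proof -
  have "P \<inter> N = {}"
  proof (rule ccontr)
    assume "P \<inter> N \<noteq> {}"
    then obtain v where "v \<in> P" "v \<in> N" by blast
    then show False using P[of v] N[of v] by simp
  qed
  moreover have "independent (P \<union> N)"
  proof (rule orthogonal_nonnull_independent[OF \<open>bilinear h\<close>])
    show "finite (P \<union> N)" using assms(2,3) by simp
    show "h v v \<noteq> 0" if "v \<in> P \<union> N" for v
      using that P[of v] N[of v] by auto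
  qed (fact orth)
  moreover have "\<forall>v\<in>P. h v v = 1" "\<forall>v\<in>N. h v v = -1"
    "\<forall>v\<in>P \<union> N. \<forall>w\<in>P \<union> N. v \<noteq> w \<longrightarrow> h v w = 0"
    using P N orth by simp_all
  ultimately show ?thesis
    unfolding has_signature_def using assms(2-5,9) by blast
qed

lemma has_signatureE:
  assumes "has_signature h p q"
  obtains P N where "finite P" "finite N" "card P = p" "card N = q"
    "\<forall>v\<in>P. h v v = 1" "\<forall>v\<in>N. h v v = -1"
    "\<forall>v\<in>P \<union> N. \<forall>w\<in>P \<union> N. v \<noteq> w \<longrightarrow> h v w = 0" "span (P \<union> N) = UNIV"
  using assms unfolding has_signature_def by (elim exE conjE) (rule that; assumption)

text \<open>
  The coordinates of the representing vector in a pseudo-orthonormal basis are the values of \<open>f\<close>,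
  corrected by the signs \<open>h v v\<close>; these square to \<open>1\<close>.
\<close>

lemma riesz_representation:
  fixes h :: "'a::real_vector \<Rightarrow> 'a \<Rightarrow> real"
  assumes "bilinear h" "has_signature h p q" "linear f"
  shows "\<exists>W. \<forall>Z. h W Z = f Z"
proof -
  obtain P N where PN: "finite P" "finite N" "span (P \<union> N) = UNIV"
    and P: "\<And>v. v \<in> P \<Longrightarrow> h v v = 1" and N: "\<And>v. v \<in> N \<Longrightarrow> h v v = -1"
    and orth: "\<And>v w. v \<in> P \<union> N \<Longrightarrow> w \<in> P \<union> N \<Longrightarrow> v \<noteq> w \<Longrightarrow> h v w = 0"
    using assms(2) by (rule has_signatureE) blast
  define B where "B = P \<union> N"
  have "finite B" using PN B_def by simp
  define W where "W = (\<Sum>v\<in>B. (h v v * f v) *\<^sub>R v)"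
  have on_basis: "h W w = f w" if w: "w \<in> B" for w
  proof -
    have lin: "linear (\<lambda>x. h x w)"
      using \<open>bilinear h\<close> by (simp add: bilinear_def)
    have sq: "h w w * h w w = 1"
      using w P[of w] N[of w] B_def by auto
    have "h W w = (\<Sum>v\<in>B. h v v * f v * h v w)"
      unfolding W_def using linear_sum[OF lin, of "\<lambda>v. (h v v * f v) *\<^sub>R v" B]
      by (simp add: linear_cmul[OF lin])
    also have "\<dots> = (\<Sum>v\<in>B. if v = w then h w w * f w * h w w else 0)"
      by (rule sum.cong) (use orth w B_def in auto)
    also have "\<dots> = h w w * h w w * f w"
      using w \<open>finite B\<close> by simp
    finally show ?thesis using sq by simp
  qed
  have "h W Z = f Z" for Z
  proof (rule linear_eq_on[where B = B])
    show "linear (h W)" using \<open>bilinear h\<close> by (simp add: bilinear_def)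
    show "Z \<in> span B" using PN(3) B_def by simp
  qed (fact \<open>linear f\<close> on_basis)+
  then show ?thesis by blast
qed

lemma span_direct_sum:
  fixes A :: "'a::real_vector set" and B :: "'b::real_vector set"
  assumes "span A = UNIV" "span B = UNIV"
  shows "span ((\<lambda>x. (x, 0)) ` A \<union> Pair 0 ` B) = UNIV" (is "span ?S = _")
proof -
  have "linear (\<lambda>x::'a. (x, 0::'b))" "linear (Pair 0 :: 'b \<Rightarrow> 'a \<times> 'b)"
    by (auto intro!: linearI)
  note im = this[THEN linear_span_image]
  have "(x, 0) \<in> span ?S" for x
  proof -
    have "(x, 0) \<in> span ((\<lambda>x. (x, 0::'b)) ` A)" unfolding im(1) using assms by blast
    then show ?thesis using span_mono[of "(\<lambda>x. (x, 0)) ` A" ?S] by blast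
  qed
  moreover have "(0, y) \<in> span ?S" for y
  proof -
    have "(0, y) \<in> span (Pair (0::'a) ` B)" unfolding im(2) using assms by blast
    then show ?thesis using span_mono[of "Pair 0 ` B" ?S] by blast
  qed
  ultimately have "(x, 0) + (0, y) \<in> span ?S" for x y by (rule span_add)
  then have "p \<in> span ?S" for p by (cases p) simp
  then show ?thesis by blast
qed

lemma finite_dim_space_prod:
  assumes "finite_dim_space TYPE('a::real_vector)" "finite_dim_space TYPE('b::real_vector)"
  shows "finite_dim_space TYPE('a \<times> 'b)"
proof -
  obtain A :: "'a set" and B :: "'b set"
    where "finite A" "span A = UNIV" "finite B" "span B = UNIV"
    using assms unfolding finite_dim_space_def by blast
  then have "finite ((\<lambda>x. (x, 0::'b)) ` A \<union> Pair (0::'a) ` B)"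
    and "span ((\<lambda>x. (x, 0::'b)) ` A \<union> Pair (0::'a) ` B) = UNIV"
    by (simp_all only: finite_Un finite_imageI span_direct_sum simp_thms)
  then show ?thesis
    unfolding finite_dim_space_def by blast
qed

lemma bilinear_direct_sum:
  assumes "bilinear h1" "bilinear h2"
  shows "bilinear (\<lambda>X Y. h1 (fst X) (fst Y) + h2 (snd X) (snd Y))"
  unfolding bilinear_def linear_iff
  by (simp add: scaleR_add_right bilinear_ladd[OF assms(1)] bilinear_ladd[OF assms(2)]
      bilinear_radd[OF assms(1)] bilinear_radd[OF assms(2)]
      bilinear_lmul[OF assms(1)] bilinear_lmul[OF assms(2)]
      bilinear_rmul[OF assms(1)] bilinear_rmul[OF assms(2)])

text \<open>
  The union of the two bases, each placed in its own summand, is a pseudo-orthonormal basis. The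
  two copies are disjoint because a basis does not contain \<open>0\<close>.
\<close>

lemma has_signature_direct_sum:
  fixes h1 :: "'a::real_vector \<Rightarrow> 'a \<Rightarrow> real" and h2 :: "'b::real_vector \<Rightarrow> 'b \<Rightarrow> real"
  assumes bil: "bilinear h1" "bilinear h2"
    and "has_signature h1 p1 q1" "has_signature h2 p2 q2"
  shows "has_signature (\<lambda>X Y. h1 (fst X) (fst Y) + h2 (snd X) (snd Y)) (p1 + p2) (q1 + q2)"
proof -
  obtain P1 N1 where 1: "finite P1" "finite N1" "card P1 = p1" "card N1 = q1"
    "\<forall>v\<in>P1. h1 v v = 1" "\<forall>v\<in>N1. h1 v v = -1"
    "\<forall>v\<in>P1 \<union> N1. \<forall>w\<in>P1 \<union> N1. v \<noteq> w \<longrightarrow> h1 v w = 0" "span (P1 \<union> N1) = UNIV"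
    using assms(3) by (rule has_signatureE)
  obtain P2 N2 where 2: "finite P2" "finite N2" "card P2 = p2" "card N2 = q2"
    "\<forall>v\<in>P2. h2 v v = 1" "\<forall>v\<in>N2. h2 v v = -1"
    "\<forall>v\<in>P2 \<union> N2. \<forall>w\<in>P2 \<union> N2. v \<noteq> w \<longrightarrow> h2 v w = 0" "span (P2 \<union> N2) = UNIV"
    using assms(4) by (rule has_signatureE)
  define join :: "'a set \<Rightarrow> 'b set \<Rightarrow> ('a \<times> 'b) set"
    where "join A B = (\<lambda>x. (x, 0)) ` A \<union> Pair 0 ` B" for A B
  note [simp] = bilinear_lzero[OF bil(1)] bilinear_rzero[OF bil(1)]
    bilinear_lzero[OF bil(2)] bilinear_rzero[OF bil(2)]
  have card_join: "card (join A B) = card A + card B"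
    if "finite A" "finite B" "0 \<notin> A" for A B
  proof -
    have "card (join A B) = card ((\<lambda>x. (x, 0::'b)) ` A) + card (Pair (0::'a) ` B)"
      unfolding join_def using that by (intro card_Un_disjoint) auto
    then show ?thesis by (simp add: card_image inj_on_def)
  qed
  have "0 \<notin> P1" using bspec[OF 1(5), of 0] by auto
  moreover have "0 \<notin> N1" using bspec[OF 1(6), of 0] by auto
  ultimately have cards: "card (join P1 P2) = p1 + p2" "card (join N1 N2) = q1 + q2"
    using 1(1-4) 2(1-4) by (simp_all add: card_join)
  have un: "join P1 P2 \<union> join N1 N2 = join (P1 \<union> N1) (P2 \<union> N2)"
    unfolding join_def by auto
  show ?thesis
  proof (rule has_signatureI[where P = "join P1 P2" and N = "join N1 N2"])
    show "span (join P1 P2 \<union> join N1 N2) = UNIV"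
      unfolding un unfolding join_def using 1(8) 2(8) by (rule span_direct_sum)
    show "bilinear (\<lambda>X Y. h1 (fst X) (fst Y) + h2 (snd X) (snd Y))"
      using bil by (rule bilinear_direct_sum)
    show "finite (join P1 P2)" "finite (join N1 N2)"
      unfolding join_def using 1(1,2) 2(1,2) by simp_all
    show "h1 (fst v) (fst v) + h2 (snd v) (snd v) = 1" if "v \<in> join P1 P2" for v
      using that 1(5) 2(5) unfolding join_def by auto
    show "h1 (fst v) (fst v) + h2 (snd v) (snd v) = -1" if "v \<in> join N1 N2" for v
      using that 1(6) 2(6) unfolding join_def by auto
    show "h1 (fst v) (fst w) + h2 (snd v) (snd w) = 0"
      if "v \<in> join P1 P2 \<union> join N1 N2" "w \<in> join P1 P2 \<union> join N1 N2" "v \<noteq> w" for v w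
      using that(3) that(1,2)[unfolded un, unfolded join_def] 1(7) 2(7) by fastforce
  qed (fact cards)+
qed

lemma linear_inv_bij:
  fixes Q :: "'b::real_vector \<Rightarrow> 'a::real_vector"
  assumes "linear Q" "bij Q"
  shows "linear (inv Q)"
proof -
  have "Q (inv Q x) = x" "inv Q (Q y) = y" for x y
    using assms(2) by (simp_all add: bij_is_surj surj_f_inv_f bij_is_inj)
  then show ?thesis
    by (intro linearI) (metis linear_add[OF assms(1)], metis linear_cmul[OF assms(1)])
qed

lemma has_signature_pullback:
  fixes h :: "'a::real_vector \<Rightarrow> 'a \<Rightarrow> real" and Q :: "'b::real_vector \<Rightarrow> 'a"
  assumes bil: "bilinear h" and Q: "linear Q" "bij Q" and sig: "has_signature h p q"
  shows "has_signature (\<lambda>X Y. h (Q X) (Q Y)) p q"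
proof -
  obtain P N where PN: "finite P" "finite N" "card P = p" "card N = q"
    "\<forall>v\<in>P. h v v = 1" "\<forall>v\<in>N. h v v = -1"
    "\<forall>v\<in>P \<union> N. \<forall>w\<in>P \<union> N. v \<noteq> w \<longrightarrow> h v w = 0" "span (P \<union> N) = UNIV"
    using sig by (rule has_signatureE)
  have QQ: "Q (inv Q x) = x" for x
    using Q(2) by (simp add: bij_is_surj surj_f_inv_f)
  have inj: "inj_on (inv Q) A" for A
    by (metis QQ inj_onI)
  have lin: "linear (inv Q)"
    using Q by (rule linear_inv_bij)
  show ?thesis
  proof (rule has_signatureI[where P = "inv Q ` P" and N = "inv Q ` N"])
    have "span (inv Q ` (P \<union> N)) = inv Q ` UNIV"
      using linear_span_image[OF lin] PN(8) by simp
    then show "span (inv Q ` P \<union> inv Q ` N) = UNIV"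
      using Q(2) by (simp add: image_Un bij_is_inj inj_imp_surj_inv)
    show "bilinear (\<lambda>X Y. h (Q X) (Q Y))"
      using bil Q(1) unfolding bilinear_def linear_iff by auto
    show "h (Q v) (Q w) = 0"
      if "v \<in> inv Q ` P \<union> inv Q ` N" "w \<in> inv Q ` P \<union> inv Q ` N" "v \<noteq> w" for v w
    proof -
      have "Q v \<in> P \<union> N" "Q w \<in> P \<union> N" using that(1,2) QQ by auto
      moreover have "Q v \<noteq> Q w" using that(3) Q(2) by (simp add: bij_is_inj inj_eq)
      ultimately show ?thesis using PN(7) by blast
    qed
  qed (use PN(1-6) in \<open>auto simp: QQ card_image inj\<close>)
qed

section \<open>The Levi-Civita connection\<close>

text \<open>
  Substituting the torsion identity into the right-hand side of the Koszul formula gives six terms;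
  skewness of \<open>D X\<close>, \<open>D Y\<close> and \<open>D Z\<close> cancels four of them and makes the other two equal to
  \<open>h (D X Y) Z\<close>.
\<close>

lemma levi_civita_unique:
  fixes h :: "'a::real_vector \<Rightarrow> 'a \<Rightarrow> real"
  assumes h: "pseudo_riemannian_metric h"
    and torsion_free: "\<And>X Y. D X Y - D Y X = br X Y"
    and metric: "\<And>X Y Z. h (D X Y) Z + h Y (D X Z) = 0"
  shows "levi_civita br h X Y = D X Y"
proof -
  have bil: "bilinear h" and sym: "\<And>X Y. h X Y = h Y X"
    and nondeg: "\<And>X. (\<And>Y. h X Y = 0) \<Longrightarrow> X = 0"
    using h unfolding pseudo_riemannian_metric_def by blast+
  have koszul: "2 * h (D X Y) Z = h (br X Y) Z - h (br Y Z) X + h (br Z X) Y" for Z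
    unfolding torsion_free[symmetric] bilinear_lsub[OF bil]
    using metric[of X Y Z] metric[of Y X Z] metric[of Z X Y]
    by (simp add: sym[of "D Y Z" X] sym[of "D Z Y" X] sym[of Y])
  show ?thesis
    unfolding levi_civita_def
  proof (rule the_equality)
    fix W assume "\<forall>Z. 2 * h W Z = h (br X Y) Z - h (br Y Z) X + h (br Z X) Y"
    with koszul have "h W Z = h (D X Y) Z" for Z
      by (metis mult_cancel_left zero_neq_numeral)
    then have "W - D X Y = 0"
      by (intro nondeg) (simp add: bilinear_lsub[OF bil])
    then show "W = D X Y" by simp
  qed (use koszul in blast)
qed

text \<open>
  The right-hand side of the Koszul formula is linear in \<open>Z\<close>, hence represented by a vector. This
  makes the definite description in the definition of the connection denote a solution.
\<close>

lemma levi_civita_koszul: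
  fixes h :: "'a::real_vector \<Rightarrow> 'a \<Rightarrow> real"
  assumes h: "pseudo_riemannian_metric h" and sig: "has_signature h p q" and br: "bilinear br"
  shows "2 * h (levi_civita br h X Y) Z = h (br X Y) Z - h (br Y Z) X + h (br Z X) Y"
proof -
  have bil: "bilinear h" and nondeg: "\<And>X. (\<And>Y. h X Y = 0) \<Longrightarrow> X = 0"
    using h unfolding pseudo_riemannian_metric_def by blast+
  have "linear (\<lambda>Z. (h (br X Y) Z - h (br Y Z) X + h (br Z X) Y) / 2)"
    using bil br unfolding bilinear_def linear_iff by (auto simp: field_simps)
  then obtain W where W: "\<And>Z. h W Z = (h (br X Y) Z - h (br Y Z) X + h (br Z X) Y) / 2"
    using riesz_representation[OF bil sig] by blast
  have "\<forall>Z. 2 * h (levi_civita br h X Y) Z = h (br X Y) Z - h (br Y Z) X + h (br Z X) Y"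
    unfolding levi_civita_def
  proof (rule theI)
    fix V assume "\<forall>Z. 2 * h V Z = h (br X Y) Z - h (br Y Z) X + h (br Z X) Y"
    then have "2 * h V Z = 2 * h W Z" for Z by (simp add: W)
    then have "h V Z = h W Z" for Z by simp
    then have "V - W = 0"
      by (intro nondeg) (simp add: bilinear_lsub[OF bil])
    then show "V = W" by simp
  qed (simp add: W)
  then show ?thesis by blast
qed

text \<open>
  Non-degeneracy reduces an equation between vectors to one between their products with a test
  vector, where the Koszul formula replaces the connection by brackets.
\<close>

lemma levi_civita_properties:
  fixes h :: "'a::real_vector \<Rightarrow> 'a \<Rightarrow> real"
  assumes h: "pseudo_riemannian_metric h" and sig: "has_signature h p q" and L: "lie_algebra br"
  shows levi_civita_bilinear: "bilinear (levi_civita br h)"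
    and levi_civita_torsion_free: "levi_civita br h X Y - levi_civita br h Y X = br X Y"
    and levi_civita_metric: "h (levi_civita br h X Y) Z + h Y (levi_civita br h X Z) = 0"
proof -
  have bil: "bilinear h" and sym: "\<And>X Y. h X Y = h Y X"
    and nondeg: "\<And>X. (\<And>Y. h X Y = 0) \<Longrightarrow> X = 0"
    using h unfolding pseudo_riemannian_metric_def by blast+
  have br: "bilinear br" and alt: "\<And>X. br X X = 0"
    using L unfolding lie_algebra_def by blast+
  have anti: "br X Y = - br Y X" for X Y
    using alt[of "X + Y"] alt[of X] alt[of Y]
    by (simp add: bilinear_ladd[OF br] bilinear_radd[OF br] eq_neg_iff_add_eq_0 add.commute)
  note K = levi_civita_koszul[OF h sig br]
  have eqI: "V = W" if "\<And>Z. 2 * h V Z = 2 * h W Z" for V W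
  proof -
    have "V - W = 0"
      by (rule nondeg) (use that in \<open>simp add: bilinear_lsub[OF bil]\<close>)
    then show ?thesis by simp
  qed
  note expand = bilinear_ladd[OF bil] bilinear_radd[OF bil] bilinear_lmul[OF bil]
    bilinear_rmul[OF bil] bilinear_lsub[OF bil] bilinear_lneg[OF bil]
    bilinear_ladd[OF br] bilinear_radd[OF br] bilinear_lmul[OF br] bilinear_rmul[OF br]
  show "bilinear (levi_civita br h)"
    unfolding bilinear_def
  proof (intro conjI allI linearI eqI; simp only: expand real_scaleR_def distrib_left mult.left_commute[of 2] K)
  qed (simp_all add: expand algebra_simps)
  show "levi_civita br h X Y - levi_civita br h Y X = br X Y"
  proof (rule eqI)
    fix Z
    show "2 * h (levi_civita br h X Y - levi_civita br h Y X) Z = 2 * h (br X Y) Z"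
      using K[of X Y Z] K[of Y X Z]
      by (simp add: expand anti[of Y X] anti[of Z Y] anti[of X Z])
  qed
  show "h (levi_civita br h X Y) Z + h Y (levi_civita br h X Z) = 0"
    using K[of X Y Z] K[of X Z Y] sym[of Y "levi_civita br h X Z"]
    by (simp add: expand anti[of Z Y] anti[of Y X] anti[of Z X])
qed

section \<open>Semidirect products\<close>

text \<open>
  In the first component of the Jacobi identity, the terms with two arguments in the ideal cancel because
  \<open>\<phi>\<close> acts by derivations, and those with one because \<open>\<phi>\<close> is a representation.
\<close>

lemma lie_algebra_semidirect:
  fixes brp :: "'p::real_vector \<Rightarrow> 'p \<Rightarrow> 'p" and brm :: "'m::real_vector \<Rightarrow> 'm \<Rightarrow> 'm"
  assumes p: "lie_algebra brp" and m: "lie_algebra brm"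
    and rep: "derivation_representation brm brp \<phi>"
  shows "lie_algebra (semidirect_bracket brp brm \<phi>)"
proof -
  have bp: "bilinear brp" and bm: "bilinear brm" and bphi: "bilinear \<phi>"
    using p m rep unfolding lie_algebra_def derivation_representation_def by blast+
  have altp: "brp X X = 0" for X using p unfolding lie_algebra_def by blast
  have jacp: "brp X (brp Y Z) + brp Y (brp Z X) + brp Z (brp X Y) = 0" for X Y Z
    using p unfolding lie_algebra_def by blast
  have antip: "brp X Y = - brp Y X" for X Y
    using altp[of "X + Y"] altp[of X] altp[of Y]
    by (simp add: bilinear_ladd[OF bp] bilinear_radd[OF bp] eq_neg_iff_add_eq_0 add.commute)
  have der: "\<phi> X (brp Y Z) = brp (\<phi> X Y) Z + brp Y (\<phi> X Z)"
    and com: "\<phi> (brm X X') Y = \<phi> X (\<phi> X' Y) - \<phi> X' (\<phi> X Y)" for X X' Y Z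
    using rep unfolding derivation_representation_def lie_derivation_def by auto
  note expand = bilinear_radd[OF bp] bilinear_rsub[OF bp] bilinear_radd[OF bphi]
    bilinear_rsub[OF bphi]
  let ?br = "semidirect_bracket brp brm \<phi>"
  have "?br X (?br Y Z) + ?br Y (?br Z X) + ?br Z (?br X Y) = 0" for X Y Z
  proof (rule prod_eqI)
    show "fst (?br X (?br Y Z) + ?br Y (?br Z X) + ?br Z (?br X Y)) = fst 0"
      using jacp[of "fst X" "fst Y" "fst Z"]
      by (simp add: semidirect_bracket_def expand der com
          antip[of "\<phi> _ _" "fst X"] antip[of "\<phi> _ _" "fst Y"] antip[of "\<phi> _ _" "fst Z"])
    show "snd (?br X (?br Y Z) + ?br Y (?br Z X) + ?br Z (?br X Y)) = snd 0"
      using m by (simp add: semidirect_bracket_def lie_algebra_def)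
  qed
  moreover have "bilinear ?br"
    using bp bm bphi unfolding bilinear_def linear_iff semidirect_bracket_def
    by (auto simp: algebra_simps)
  moreover have "?br X X = 0" for X
    using m by (simp add: semidirect_bracket_def altp lie_algebra_def prod_eq_iff)
  moreover have "finite_dim_space TYPE('p \<times> 'm)"
    using p m finite_dim_space_prod unfolding lie_algebra_def by blast
  ultimately show ?thesis unfolding lie_algebra_def by blast
qed

lemma pseudo_riemannian_metric_direct_sum:
  assumes h1: "pseudo_riemannian_metric h1" and h2: "pseudo_riemannian_metric h2"
  shows "pseudo_riemannian_metric (\<lambda>X Y. h1 (fst X) (fst Y) + h2 (snd X) (snd Y))"
proof -
  have bil: "bilinear h1" "bilinear h2"
    using h1 h2 unfolding pseudo_riemannian_metric_def by blast+
  have "X = 0" if "\<And>Y. h1 (fst X) (fst Y) + h2 (snd X) (snd Y) = 0" for X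
  proof -
    have "h1 (fst X) y = 0" for y
      using that[of "(y, 0)"] by (simp add: bilinear_rzero[OF bil(2)])
    moreover have "h2 (snd X) y = 0" for y
      using that[of "(0, y)"] by (simp add: bilinear_rzero[OF bil(1)])
    ultimately show ?thesis
      using h1 h2 unfolding pseudo_riemannian_metric_def by (simp add: prod_eq_iff)
  qed
  then show ?thesis
    using h1 h2 bilinear_direct_sum[OF bil] unfolding pseudo_riemannian_metric_def by simp
qed

lemma pseudo_riemannian_metric_pullback:
  assumes h: "pseudo_riemannian_metric h" and Q: "linear Q" "bij Q"
  shows "pseudo_riemannian_metric (\<lambda>X Y. h (Q X) (Q Y))"
proof -
  have "X = 0" if "\<And>Y. h (Q X) (Q Y) = 0" for X
  proof -
    have "h (Q X) y = 0" for y
      using that[of "inv Q y"] Q(2) by (simp add: bij_is_surj surj_f_inv_f)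
    then have "Q X = Q 0"
      using h linear_0[OF Q(1)] unfolding pseudo_riemannian_metric_def by simp
    then show ?thesis using Q(2) by (simp add: bij_is_inj inj_eq)
  qed
  moreover have "bilinear (\<lambda>X Y. h (Q X) (Q Y))"
    using h Q(1) unfolding pseudo_riemannian_metric_def bilinear_def linear_iff by auto
  ultimately show ?thesis
    using h unfolding pseudo_riemannian_metric_def by simp
qed

text \<open>
  Because the ideal is abelian and \<open>\<phi>\<close> preserves \<open>hp\<close> infinitesimally, differentiation along
  the ideal is zero, and differentiation along the complement is \<open>\<phi>\<close> on the ideal.
\<close>

lemma levi_civita_semidirect:
  fixes hp :: "'p::real_vector \<Rightarrow> 'p \<Rightarrow> real" and hm :: "'m::real_vector \<Rightarrow> 'm \<Rightarrow> real"
  assumes hp: "pseudo_riemannian_metric hp"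
    and hm: "pseudo_riemannian_metric hm" "has_signature hm p q"
    and m: "lie_algebra brm"
    and skew: "\<And>X Y Z. hp (\<phi> X Y) Z + hp Y (\<phi> X Z) = 0"
  shows "levi_civita (semidirect_bracket (\<lambda>X Y. 0) brm \<phi>)
      (\<lambda>X Y. hp (fst X) (fst Y) + hm (snd X) (snd Y)) X Y =
    (\<phi> (snd X) (fst Y), levi_civita brm hm (snd X) (snd Y))"
proof (rule levi_civita_unique[where D = "\<lambda>X Y. (\<phi> (snd X) (fst Y), levi_civita brm hm (snd X) (snd Y))"])
  show "pseudo_riemannian_metric (\<lambda>X Y. hp (fst X) (fst Y) + hm (snd X) (snd Y))"
    using hp hm(1) by (rule pseudo_riemannian_metric_direct_sum)
next
  fix X Y
  show "(\<phi> (snd X) (fst Y), levi_civita brm hm (snd X) (snd Y)) -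
      (\<phi> (snd Y) (fst X), levi_civita brm hm (snd Y) (snd X)) =
      semidirect_bracket (\<lambda>X Y. 0) brm \<phi> X Y"
    by (simp add: semidirect_bracket_def levi_civita_torsion_free[OF hm m])
next
  fix X Y Z
  show "hp (fst (\<phi> (snd X) (fst Y), levi_civita brm hm (snd X) (snd Y))) (fst Z) +
      hm (snd (\<phi> (snd X) (fst Y), levi_civita brm hm (snd X) (snd Y))) (snd Z) +
      (hp (fst Y) (fst (\<phi> (snd X) (fst Z), levi_civita brm hm (snd X) (snd Z))) +
       hm (snd Y) (snd (\<phi> (snd X) (fst Z), levi_civita brm hm (snd X) (snd Z)))) = 0"
    using skew[of "snd X" "fst Y" "fst Z"]
      levi_civita_metric[OF hm m, of "snd X" "snd Y" "snd Z"] by simp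
qed

text \<open>
  Vanishing curvature says exactly that \<open>\<nabla>\<close> turns brackets into commutators, a property that survives
  conjugation by \<open>Q\<close>. Every endomorphism of an abelian algebra is a derivation.
\<close>

lemma derivation_representation_flat:
  fixes Q :: "'p::real_vector \<Rightarrow> 'm::real_vector"
  assumes flat: "flat_metric br h" and bil: "bilinear (levi_civita br h)"
    and Q: "linear Q" "bij Q"
  shows "derivation_representation br (\<lambda>X Y. 0) (\<lambda>X Y. inv Q (levi_civita br h X (Q Y)))"
proof -
  have QQ: "Q (inv Q x) = x" for x
    using Q(2) by (simp add: bij_is_surj surj_f_inv_f)
  have lin: "linear (inv Q)"
    using Q by (rule linear_inv_bij)
  have b: "bilinear (\<lambda>X Y. inv Q (levi_civita br h X (Q Y)))"
    using bil Q(1) lin unfolding bilinear_def linear_iff by simp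
  have "levi_civita br h (br X Y) Z = levi_civita br h X (levi_civita br h Y Z)
      - levi_civita br h Y (levi_civita br h X Z)" for X Y Z
  proof -
    have "curvature br h X Y Z = 0"
      using flat unfolding flat_metric_def by blast
    then show ?thesis
      unfolding curvature_def by (metis right_minus_eq)
  qed
  then have "inv Q (levi_civita br h (br X Y) (Q Z)) =
      inv Q (levi_civita br h X (Q (inv Q (levi_civita br h Y (Q Z)))))
      - inv Q (levi_civita br h Y (Q (inv Q (levi_civita br h X (Q Z)))))" for X Y Z
    by (simp only: QQ linear_diff[OF lin])
  moreover have "linear (\<lambda>Y. inv Q (levi_civita br h X (Q Y)))" for X
    using b by (simp add: bilinear_def)
  ultimately show ?thesis
    using b unfolding derivation_representation_def lie_derivation_def
    by (simp add: bilinear_rzero[OF b])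
qed

section \<open>The hypersymplectic structure\<close>

theorem proposition3p14:
  fixes n :: nat
    and brm :: "'m::real_vector \<Rightarrow> 'm \<Rightarrow> 'm"
    and hm :: "'m \<Rightarrow> 'm \<Rightarrow> real"
    and Em :: "'m \<Rightarrow> 'm"
    and nablam :: "'m \<Rightarrow> 'm \<Rightarrow> 'm"
    and brp :: "'p::real_vector \<Rightarrow> 'p \<Rightarrow> 'p"
    and hp :: "'p \<Rightarrow> 'p \<Rightarrow> real"
    and Ep :: "'p \<Rightarrow> 'p"
    and Q :: "'p \<Rightarrow> 'm"
    and \<phi> :: "'m \<Rightarrow> 'p \<Rightarrow> 'p"
    and h :: "'p \<times> 'm \<Rightarrow> 'p \<times> 'm \<Rightarrow> real"
    and J E :: "'p \<times> 'm \<Rightarrow> 'p \<times> 'm"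
  assumes "flat_bi_lagrangian brm hm Em"
    and "dim (UNIV :: 'm set) = 2 * n"
    and "nablam = levi_civita brm hm"
    and "finite_dim_space TYPE('p)" and "dim (UNIV :: 'p set) = 2 * n"
    and "brp = (\<lambda>X Y. 0)"
    and "linear Q" and "bij Q"
    and "hp = (\<lambda>X Y. hm (Q X) (Q Y))"
    and "Ep = (\<lambda>X. - inv Q (Em (Q X)))"
    and "\<phi> = (\<lambda>X Y. inv Q (nablam X (Q Y)))"
    and "h = (\<lambda>X Y. hp (fst X) (fst Y) + hm (snd X) (snd Y))"
    and "J = (\<lambda>X. (- inv Q (snd X), Q (fst X)))"
    and "E = (\<lambda>X. (Ep (fst X), Em (snd X)))"
  shows "derivation_representation brm brp \<phi> \<and>
         hypersymplectic (semidirect_bracket brp brm \<phi>) h J E"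
proof -
  have m: "lie_algebra brm" and hm: "pseudo_riemannian_metric hm" and neu: "neutral_signature hm"
    and Em: "linear Em" "\<And>X. Em (Em X) = X" "\<And>X Y. hm (Em X) (Em Y) = - hm X Y"
      "parallel_endo brm hm Em"
    and flat: "flat_metric brm hm"
    using assms(1) unfolding flat_bi_lagrangian_def bi_lagrangian_def by blast+
  obtain r where sig: "has_signature hm r r"
    using neu unfolding neutral_signature_def by blast
  have bil: "bilinear hm"
    using hm unfolding pseudo_riemannian_metric_def by blast
  have Q: "linear Q" "bij Q" by fact+
  have QQ: "Q (inv Q x) = x" "inv Q (Q y) = y" for x y
    using Q(2) by (simp_all add: bij_is_surj surj_f_inv_f bij_is_inj)
  have lin: "linear (inv Q)"
    using Q by (rule linear_inv_bij)
  note nabla = assms(3) and \<phi> = assms(11)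
  have nabla_bil: "bilinear nablam"
    unfolding nabla by (rule levi_civita_bilinear[OF hm sig m])
  have nabla_E: "nablam X (Em Y) = Em (nablam X Y)" for X Y
    using Em(4) unfolding parallel_endo_def nabla by simp
  have rep: "derivation_representation brm brp \<phi>"
    unfolding assms(6) \<phi> nabla
    by (rule derivation_representation_flat[OF flat levi_civita_bilinear[OF hm sig m] Q])
  have p: "lie_algebra brp"
    using assms(4) unfolding lie_algebra_def assms(6) by (simp add: bilinear_def linear_iff)
  have g: "lie_algebra (semidirect_bracket brp brm \<phi>)"
    using p m rep by (rule lie_algebra_semidirect)
  have hp: "pseudo_riemannian_metric hp"
    unfolding assms(9) using hm Q by (rule pseudo_riemannian_metric_pullback)
  then have bilp: "bilinear hp"
    unfolding pseudo_riemannian_metric_def by blast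
  have h: "pseudo_riemannian_metric h"
    unfolding assms(12) using hp hm by (rule pseudo_riemannian_metric_direct_sum)
  have "has_signature hp r r"
    unfolding assms(9) using bil Q sig by (rule has_signature_pullback)
  then have "has_signature h (r + r) (r + r)"
    unfolding assms(12) using sig by (rule has_signature_direct_sum[OF bilp bil])
  then have h_neutral: "neutral_signature h"
    unfolding neutral_signature_def by blast
  have skew: "hp (\<phi> X Y) Z + hp Y (\<phi> X Z) = 0" for X Y Z
    unfolding assms(9) \<phi> nabla using levi_civita_metric[OF hm sig m] by (simp add: QQ)
  have LC: "levi_civita (semidirect_bracket brp brm \<phi>) h X Y =
      (\<phi> (snd X) (fst Y), nablam (snd X) (snd Y))" for X Y
    using levi_civita_semidirect[where \<phi> = \<phi>, OF hp hm sig m skew]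
    by (simp only: assms(6,12) nabla)
  have nabla_neg: "nablam X (- Y) = - nablam X Y" for X Y
    by (rule bilinear_rneg[OF nabla_bil])
  note neg = nabla_neg linear_neg[OF lin] linear_neg[OF Q(1)] linear_neg[OF Em(1)]
    bilinear_lneg[OF bil] bilinear_rneg[OF bil]
  have "pseudo_kaehler (semidirect_bracket brp brm \<phi>) h J"
    unfolding pseudo_kaehler_def
  proof (intro conjI allI)
    show "linear J"
      using lin Q(1) unfolding assms(13) linear_iff by simp
    show "parallel_endo (semidirect_bracket brp brm \<phi>) h J"
      unfolding parallel_endo_def LC by (simp add: assms(13) \<phi> neg QQ)
    show "J (J X) = - X" "h (J X) (J Y) = h X Y" for X Y
      by (simp_all add: assms(9,12,13) neg QQ prod_eq_iff)
  qed (fact g h)+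
  moreover have "bi_lagrangian (semidirect_bracket brp brm \<phi>) h E"
    unfolding bi_lagrangian_def
  proof (intro conjI allI)
    show "linear E"
      using lin Q(1) Em(1) unfolding assms(10,14) linear_iff by simp
    show "parallel_endo (semidirect_bracket brp brm \<phi>) h E"
      unfolding parallel_endo_def LC by (simp add: assms(10,14) \<phi> neg QQ nabla_E)
    show "E (E X) = X" "h (E X) (E Y) = - h X Y" for X Y
      by (simp_all add: assms(9,10,12,14) neg QQ Em prod_eq_iff)
  qed (fact g h h_neutral)+
  moreover have "J (E X) = - E (J X)" for X
    by (simp add: assms(10,13,14) neg QQ)
  ultimately show ?thesis
    using rep unfolding hypersymplectic_def by blast
qed

end
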